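(* A (finite) $3$-uniform hypergraph $\mathcal{H}$ has a good colouring if, and only if, $\mathcal{H}$ has no pseudocycle of length $\ell$ for any positive integer $\ell$ with $3 \nmid \ell$.
   Context: A pseudocycle of length $\ell$ in a $3$-uniform hypergraph $\mathcal{H}$ is a sequence of (not necessarily distinct) vertices $v_1,\dots,v_\ell$ such that for each $i\in\{1,\dots,\ell\}$ the set $\{v_i,v_{i+1},v_{i+2}\}$ (indices modulo $\ell$) is an edge of $\mathcal{H}$ (in particular these three vertices are distinct). The shadow $\partial\mathcal{H}$ of $\mathcal{H}$ is the graph on $V(\mathcal{H})$ whose edges are the pairs $xy$ contained in some edge of $\mathcal{H}$. A good colouring of $\mathcal{H}$ is a colouring of the edges of its shadow such that each edge of the shadow is either coloured blue, or coloured red and given an orientation, and every edge of $\mathcal{H}$ can be written as $xyz$ where $xy$ and $xz$ are red and directed from $x$ (i.e. $x\to y$, $x\to z$) and $yz$ is blue. *)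

theory Defs
  imports Main
begin

definition finite_hypergraph3 :: "'a set \<Rightarrow> 'a set set \<Rightarrow> bool" where
  "finite_hypergraph3 V E \<longleftrightarrow> finite V \<and> (\<forall>e\<in>E. e \<subseteq> V \<and> card e = 3)"

(* Indices run from 0 to length vs - 1; distinctness of three cyclically consecutive
   vertices is enforced because every edge has cardinality 3. *)
definition pseudocycle :: "'a set \<Rightarrow> 'a set set \<Rightarrow> 'a list \<Rightarrow> bool" where
  "pseudocycle V E vs \<longleftrightarrow> set vs \<subseteq> V \<and>
     (\<forall>i<length vs.
        {vs ! i, vs ! ((i + 1) mod length vs), vs ! ((i + 2) mod length vs)} \<in> E)"

definition has_pseudocycle_of_length :: "'a set \<Rightarrow> 'a set set \<Rightarrow> nat \<Rightarrow> bool" where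
  "has_pseudocycle_of_length V E l \<longleftrightarrow> (\<exists>vs. length vs = l \<and> pseudocycle V E vs)"

definition shadow_edges :: "'a set set \<Rightarrow> 'a set set" where
  "shadow_edges E = {{x, y} | x y. x \<noteq> y \<and> (\<exists>e\<in>E. {x, y} \<subseteq> e)}"

(* Red x y: red, directed from x to y. *)
datatype 'a edge_colour = Blue | Red 'a 'a

(* Colourings are total functions on vertex sets; only the values on shadow edges matter.
   A red shadow edge must be oriented between its own two endpoints. *)
definition shadow_colouring :: "'a set set \<Rightarrow> ('a set \<Rightarrow> 'a edge_colour) \<Rightarrow> bool" where
  "shadow_colouring E c \<longleftrightarrow>
     (\<forall>p\<in>shadow_edges E. c p = Blue \<or> (\<exists>x y. p = {x, y} \<and> c p = Red x y))"

definition good_colouring :: "'a set set \<Rightarrow> ('a set \<Rightarrow> 'a edge_colour) \<Rightarrow> bool" where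
  "good_colouring E c \<longleftrightarrow> shadow_colouring E c \<and>
     (\<forall>e\<in>E. \<exists>x y z. e = {x, y, z} \<and>
        c {x, y} = Red x y \<and> c {x, z} = Red x z \<and> c {y, z} = Blue)"

end

(* Let two ordered pairs (a, b) and (b, c) be adjacent when {a, b, c} is an edge, so that
   pseudocycles are the closed walks on ordered pairs. Encode a colour of the pair xy as an
   antisymmetric value F(x, y) in Z/3: 0 for blue, 1 for red from x to y, 2 for red from y to x.
   Then a colouring is good iff F(b, c) = F(a, b) + 2 for every adjacency. Going around a
   pseudocycle of length l gives 2 l = 0 in Z/3. Conversely, if all closed walks have length
   divisible by 3, there is a potential f with f(b, c) = f(a, b) + 1, and the antisymmetrisation
   F(x, y) = f(x, y) - f(y, x) has step 1 + 1 = 2. *)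
theory Submission
  imports Defs
begin

text \<open>The potential of \<open>p\<close> is the length of some walk to \<open>p\<close> from a
  base point of its component. Modulo \<open>d\<close> the walk chosen is irrelevant: two walks with
  the same ends close up with the same return walk, which exists by \<open>inverse\<close>.\<close>

lemma relpow_potential:
  fixes R :: "('p \<times> 'p) set" and d :: nat
  assumes inverse: "\<And>p q. (p, q) \<in> R \<Longrightarrow> (q, p) \<in> R\<^sup>*"
    and closed: "\<And>p l. (p, p) \<in> R ^^ l \<Longrightarrow> d dvd l"
  obtains f :: "'p \<Rightarrow> int" where "\<And>p q. (p, q) \<in> R \<Longrightarrow> int d dvd f q - f p - 1"
proof -
  have sym: "(q, p) \<in> R\<^sup>*" if "(p, q) \<in> R\<^sup>*" for p q
    using that by (induction rule: rtrancl_induct) (auto intro: inverse rtrancl_trans)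
  have same: "int d dvd int m - int n" if m: "(r, p) \<in> R ^^ m" and n: "(r, p) \<in> R ^^ n" for r p m n
  proof -
    obtain k where k: "(p, r) \<in> R ^^ k"
      using sym[OF relpow_imp_rtrancl[OF m]] rtrancl_imp_relpow by metis
    have "d dvd m + k" "d dvd n + k"
      using closed m n k by (metis relpow_add relcomp.relcompI)+
    then have "int d dvd int (m + k) - int (n + k)"
      by (intro dvd_diff) (simp_all only: int_dvd_int_iff)
    then show ?thesis by simp
  qed
  \<comment> \<open>The choice depends on \<open>p\<close> only through the set of points reaching
    it. This set agrees at both ends of a step, so the base points are literally equal.\<close>
  define rep where "rep p = (SOME r. (r, p) \<in> R\<^sup>*)" for p
  define len where "len p = (SOME n. (rep p, p) \<in> R ^^ n)" for p
  have len: "(rep p, p) \<in> R ^^ len p" for p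
  proof -
    have "(rep p, p) \<in> R\<^sup>*"
      unfolding rep_def by (rule someI[of _ p]) simp
    then show ?thesis
      unfolding len_def by (metis rtrancl_imp_relpow someI_ex)
  qed
  show thesis
  proof
    fix p q assume pq: "(p, q) \<in> R"
    have "(r, p) \<in> R\<^sup>* \<longleftrightarrow> (r, q) \<in> R\<^sup>*" for r
      using pq inverse[OF pq] by (meson rtrancl.rtrancl_into_rtrancl rtrancl_trans)
    then have "rep p = rep q" by (simp add: rep_def)
    then have "(rep q, q) \<in> R ^^ Suc (len p)"
      using len[of p] pq by auto
    from same[OF len[of q] this] show "int d dvd int (len q) - int (len p) - 1"
      by (simp add: algebra_simps)
  qed
qed

definition pair_step :: "'a set set \<Rightarrow> (('a \<times> 'a) \<times> ('a \<times> 'a)) set" where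
  "pair_step E = {((a, b), (b, c)) | a b c. {a, b, c} \<in> E}"

lemma pair_step_iff: "(p, q) \<in> pair_step E \<longleftrightarrow> snd p = fst q \<and> {fst p, snd p, snd q} \<in> E"
  by (cases p; cases q) (auto simp: pair_step_def)

text \<open>Rotating an edge gives the closed walk \<open>(a, b)\<close>, \<open>(b, c)\<close>,
  \<open>(c, a)\<close>, \<open>(a, b)\<close>, so two further steps undo one.\<close>

lemma pair_step_back:
  assumes "(p, q) \<in> pair_step E"
  shows "(q, p) \<in> (pair_step E)\<^sup>*"
proof -
  obtain a b c where p: "p = (a, b)" and q: "q = (b, c)" and e: "{a, b, c} \<in> E"
    using assms by (auto simp: pair_step_def)
  have "{b, c, a} = {a, b, c}" "{c, a, b} = {a, b, c}" by auto
  then have "(q, (c, a)) \<in> pair_step E" "((c, a), p) \<in> pair_step E"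
    using e by (simp_all add: p q pair_step_iff)
  then show ?thesis by (meson converse_rtrancl_into_rtrancl r_into_rtrancl)
qed

lemma closed_walk_pseudocycle:
  assumes E: "\<forall>e\<in>E. e \<subseteq> V" and walk: "(p, p) \<in> pair_step E ^^ l" and "l > 0"
  shows "has_pseudocycle_of_length V E l"
proof -
  obtain s where s0: "s 0 = p" and sl: "s l = p"
    and s: "\<And>i. i < l \<Longrightarrow> (s i, s (Suc i)) \<in> pair_step E"
    using walk by (auto simp: relpow_fun_conv)
  \<comment> \<open>Since \<open>s l = s 0\<close>, cyclic indices of the list can be traded for
    linear indices of the walk.\<close>
  have wrap: "s (Suc i mod l) = s (Suc i)" if "i < l" for i
    using that s0 sl by (cases "Suc i = l") auto
  define vs where "vs = map (fst \<circ> s) [0..<l]"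
  have nth: "vs ! i = fst (s i)" if "i < l" for i
    using that by (simp add: vs_def)
  have next1: "vs ! (Suc i mod l) = snd (s i)" if "i < l" for i
    using nth[of "Suc i mod l"] wrap[OF that] s[OF that] \<open>l > 0\<close> by (simp add: pair_step_iff)
  have next2: "vs ! (Suc (Suc i) mod l) = snd (s (Suc i))" if "i < l" for i
    using next1[of "Suc i mod l"] wrap[OF that] \<open>l > 0\<close> by (simp add: mod_Suc_eq)
  have edge: "{vs ! i, vs ! (Suc i mod l), vs ! (Suc (Suc i) mod l)} \<in> E" if "i < l" for i
    using s[OF that] unfolding nth[OF that] next1[OF that] next2[OF that] pair_step_iff by metis
  have len: "length vs = l" by (simp add: vs_def)
  have "set vs \<subseteq> V"
  proof
    fix v assume "v \<in> set vs"
    then obtain i where "i < l" "v = vs ! i" by (metis in_set_conv_nth len)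
    then show "v \<in> V" using edge[of i] E by blast
  qed
  then have "pseudocycle V E vs"
    using edge by (simp add: pseudocycle_def len)
  then show ?thesis using len by (auto simp: has_pseudocycle_of_length_def)
qed

text \<open>The default 2 stands for \<open>Red y x\<close>, the only remaining colour on the pairs
  of an edge.\<close>

definition colour_code :: "('a set \<Rightarrow> 'a edge_colour) \<Rightarrow> 'a \<Rightarrow> 'a \<Rightarrow> nat" where
  "colour_code c x y = (if c {x, y} = Blue then 0 else if c {x, y} = Red x y then 1 else 2)"

text \<open>With \<open>x\<close> the source of the red pairs, the codes of \<open>xy\<close>,
  \<open>yz\<close>, \<open>zx\<close> are 1, 0, 2, and so are those of \<open>xz\<close>,
  \<open>zy\<close>, \<open>yx\<close>. In this cyclic order each code is its predecessor plus 2
  modulo 3.\<close>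

lemma colour_code_step:
  assumes good: "good_colouring E c" and e: "{u, v, w} \<in> E" and "card {u, v, w} = 3"
  shows "colour_code c v w mod 3 = (colour_code c u v + 2) mod 3"
proof -
  obtain x y z where xyz: "{u, v, w} = {x, y, z}"
    and c: "c {x, y} = Red x y" "c {x, z} = Red x z" "c {y, z} = Blue"
    using good[unfolded good_colouring_def, THEN conjunct2, rule_format, OF e] by metis
  then have c': "c {y, x} = Red x y" "c {z, x} = Red x z" "c {z, y} = Blue"
    by (simp_all add: insert_commute)
  have dist: "u \<noteq> v" "u \<noteq> w" "v \<noteq> w"
    using assms(3) by (auto simp: card_insert_if split: if_splits)
  have "u \<in> {x, y, z}" "v \<in> {x, y, z}" "w \<in> {x, y, z}" using xyz by auto
  then consider "u = x" "v = y" "w = z" | "u = x" "v = z" "w = y" | "u = y" "v = x" "w = z"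
    | "u = y" "v = z" "w = x" | "u = z" "v = x" "w = y" | "u = z" "v = y" "w = x"
    using dist by auto
  then show ?thesis
    by cases (use c c' dist in \<open>auto simp: colour_code_def\<close>)
qed

lemma good_colouring_pseudocycle_dvd:
  assumes good: "good_colouring E c" and E: "\<forall>e\<in>E. card e = 3"
    and cyc: "pseudocycle V E vs" and "length vs > 0"
  shows "3 dvd length vs"
proof -
  define l where "l = length vs"
  \<comment> \<open>The periodic extension lets the induction run past the end of the list.\<close>
  define w where "w i = vs ! (i mod l)" for i
  have "l > 0" using assms(4) by (simp add: l_def)
  have edge: "{w i, w (Suc i), w (Suc (Suc i))} \<in> E" for i
  proof -
    have "i mod l < l" using \<open>l > 0\<close> by simp
    then have "{vs ! (i mod l), vs ! ((i mod l + 1) mod l), vs ! ((i mod l + 2) mod l)} \<in> E"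
      using cyc by (simp add: pseudocycle_def l_def)
    then show ?thesis by (simp add: w_def mod_simps)
  qed
  have code: "colour_code c (w i) (w (Suc i)) mod 3
      = (colour_code c (w 0) (w (Suc 0)) + 2 * i) mod 3" for i
  proof (induction i)
    case (Suc i)
    have "colour_code c (w (Suc i)) (w (Suc (Suc i))) mod 3
        = (colour_code c (w i) (w (Suc i)) + 2) mod 3"
      using colour_code_step[OF good edge] edge E by blast
    also have "\<dots> = (colour_code c (w i) (w (Suc i)) mod 3 + 2) mod 3"
      by (simp add: mod_simps)
    also have "\<dots> = (colour_code c (w 0) (w (Suc 0)) + 2 * Suc i) mod 3"
      unfolding Suc.IH by (simp add: mod_simps)
    finally show ?case .
  qed simp
  have "w (i + l) = w i" for i by (simp add: w_def)
  \<comment> \<open>After \<open>l\<close> steps the walk is back at its first pair, so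
    \<open>2 * l\<close> vanishes modulo 3.\<close>
  from this[of 0] this[of "Suc 0"] show ?thesis using code[of l] unfolding l_def[symmetric] by simp presburger
qed

text \<open>An unordered pair is read in the order in which \<open>F\<close> is 1 modulo 3. For
  antisymmetric \<open>F\<close> there is at most one such order, as the other one gives 2.\<close>

definition code_colouring :: "('a \<Rightarrow> 'a \<Rightarrow> int) \<Rightarrow> 'a set \<Rightarrow> 'a edge_colour" where
  "code_colouring F e =
     (if \<exists>x y. e = {x, y} \<and> F x y mod 3 = 1
      then SOME r. \<exists>x y. e = {x, y} \<and> F x y mod 3 = 1 \<and> r = Red x y
      else Blue)"

context
  fixes F :: "'a \<Rightarrow> 'a \<Rightarrow> int"
  assumes antisym: "F y x = - F x y"
begin

lemma code_colouring_Red: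
  assumes "F x y mod 3 = 1"
  shows "code_colouring F {x, y} = Red x y"
proof -
  have unique: "a = x \<and> b = y" if "{x, y} = {a, b}" "F a b mod 3 = 1" for a b
  proof -
    have "F y x mod 3 \<noteq> 1" using assms antisym[of y x] by presburger
    then show ?thesis using that by (metis doubleton_eq_iff)
  qed
  have "(SOME r. \<exists>a b. {x, y} = {a, b} \<and> F a b mod 3 = 1 \<and> r = Red a b) = Red x y"
    using assms unique by (intro some_equality) blast+
  then show ?thesis using assms by (auto simp: code_colouring_def)
qed

lemma code_colouring_Blue:
  assumes "F x y mod 3 = 0"
  shows "code_colouring F {x, y} = Blue"
proof -
  have "F y x mod 3 = 0" using assms antisym[of y x] by presburger
  then have "\<not> (\<exists>a b. {x, y} = {a, b} \<and> F a b mod 3 = 1)"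
    using assms by (auto simp: doubleton_eq_iff)
  then show ?thesis unfolding code_colouring_def by (rule if_not_P)
qed

text \<open>Around an edge the three values of \<open>F\<close> run through all residues modulo 3.
  The pair with value 0 is blue, and the vertex opposite to it is the source of both red
  pairs.\<close>

lemma good_code_colouring:
  assumes E: "\<forall>e\<in>E. card e = 3"
    and step: "\<And>x y z. {x, y, z} \<in> E \<Longrightarrow> F y z mod 3 = (F x y + 2) mod 3"
  shows "good_colouring E (code_colouring F)"
  unfolding good_colouring_def shadow_colouring_def
proof (intro conjI ballI)
  fix e
  show "code_colouring F e = Blue \<or> (\<exists>x y. e = {x, y} \<and> code_colouring F e = Red x y)"
    by (metis code_colouring_Red code_colouring_def)
next
  fix e assume "e \<in> E"
  have apex: "\<exists>x y z. e = {x, y, z} \<and> code_colouring F {x, y} = Red x y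
      \<and> code_colouring F {x, z} = Red x z \<and> code_colouring F {y, z} = Blue"
    if e: "e = {x, y, z}" and yz: "F y z mod 3 = 0" for x y z
  proof -
    have "{y, z, x} = e" "{x, y, z} = e" using e by auto
    then have "F z x mod 3 = (F y z + 2) mod 3" "F y z mod 3 = (F x y + 2) mod 3"
      using step[of y z x] step[of x y z] \<open>e \<in> E\<close> by simp_all
    then have "F x z mod 3 = 1" "F x y mod 3 = 1"
      using yz antisym[of x z] by presburger+
    then show ?thesis
      using e yz
      by (intro exI[of _ x] exI[of _ y] exI[of _ z]) (simp add: code_colouring_Red code_colouring_Blue)
  qed
  obtain u v w where e: "e = {u, v, w}"
    using E \<open>e \<in> E\<close> by (metis card_3_iff)
  have rot: "e = {v, w, u}" "e = {w, u, v}" using e by auto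
  have "F v w mod 3 = (F u v + 2) mod 3" "F w u mod 3 = (F v w + 2) mod 3"
    using step[of u v w] step[of v w u] e rot \<open>e \<in> E\<close> by simp_all
  then have "F v w mod 3 = 0 \<or> F w u mod 3 = 0 \<or> F u v mod 3 = 0"
    by presburger
  then show "\<exists>x y z. e = {x, y, z} \<and> code_colouring F {x, y} = Red x y
      \<and> code_colouring F {x, z} = Red x z \<and> code_colouring F {y, z} = Blue"
    using apex[OF e] apex[OF rot(1)] apex[OF rot(2)] by argo
qed

end

lemma good_colouring_exists:
  assumes E: "\<forall>e\<in>E. e \<subseteq> V \<and> card e = 3"
    and no: "\<And>l. l > 0 \<Longrightarrow> has_pseudocycle_of_length V E l \<Longrightarrow> 3 dvd l"
  shows "\<exists>c. good_colouring E c"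
proof -
  have "3 dvd l" if "(p, p) \<in> pair_step E ^^ l" for p l
    \<comment> \<open>The empty walk is split off because \<open>no\<close> speaks of positive
      lengths only.\<close>
    using closed_walk_pseudocycle[OF _ that] no E by (cases "l = 0") auto
  with pair_step_back obtain f :: "'a \<times> 'a \<Rightarrow> int"
    where f: "\<And>p q. (p, q) \<in> pair_step E \<Longrightarrow> int 3 dvd f q - f p - 1"
    using relpow_potential[of "pair_step E" 3] by metis
  define F where "F x y = f (x, y) - f (y, x)" for x y
  have "F y z mod 3 = (F x y + 2) mod 3" if "{x, y, z} \<in> E" for x y z
  proof -
    have "{z, y, x} = {x, y, z}" by auto
    \<comment> \<open>Traversing the edge backwards is also a step. Each of the two steps raises
      \<open>f\<close> by 1 modulo 3, and their sum is the increment 2 of \<open>F\<close>.\<close>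
    then have "((x, y), (y, z)) \<in> pair_step E" "((z, y), (y, x)) \<in> pair_step E"
      using that by (simp_all add: pair_step_iff)
    from dvd_add[OF f[OF this(1)] f[OF this(2)]]
    have "3 dvd F y z - (F x y + 2)" by (simp add: F_def algebra_simps)
    then show ?thesis by (simp add: mod_eq_dvd_iff)
  qed
  then have "good_colouring E (code_colouring F)"
    using E by (intro good_code_colouring) (auto simp: F_def)
  then show ?thesis by blast
qed

theorem theorem2p4:
  fixes V :: "'a set" and E :: "'a set set"
  assumes "finite_hypergraph3 V E"
  shows "(\<exists>c. good_colouring E c) \<longleftrightarrow>
         (\<forall>l::nat. l > 0 \<and> \<not> 3 dvd l \<longrightarrow> \<not> has_pseudocycle_of_length V E l)"
proof -
  have E: "\<forall>e\<in>E. e \<subseteq> V \<and> card e = 3"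
    using assms by (simp add: finite_hypergraph3_def)
  show ?thesis
    using good_colouring_pseudocycle_dvd[of E _ V] good_colouring_exists[OF E] E
    by (metis has_pseudocycle_of_length_def)
qed

end
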